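(* Consider absorbing (masked) diffusion on sequences of length $d$, with independent coordinates and single-token forward marginals $$q_t(x\mid x_0)=\alpha_t\,\delta_{x_0}(x)+(1-\alpha_t)\,\delta_{\text{[MASK]}}(x).$$ Then the token-level denoising score entropy loss $\mathcal L^\theta_{\mathrm{DSE}}(x_0)$ defined in the context equals, up to an additive term independent of $\theta$, the weighted masked-language-modelling loss $$\mathcal L^\theta_{\mathrm{MLM}}(x_0)=\int_0^1\mathbb E_{x_t\sim q(\cdot\mid x_0)}\left[\frac{\alpha_t'}{1-\alpha_t}\sum_{k=1}^d\delta_{\text{[MASK]}}(x_t^{(k)})\,\log p^\theta(x_0^{(k)}\mid x_t,t)\right]dt.$$
   Context: The token alphabet is $\{1,\dots,K\}\cup\{\text{[MASK]}\}$; the clean sequence $x_0=(x_0^{(1)},\dots,x_0^{(d)})$ has no [MASK] tokens. $\alpha_t$ is a non-increasing differentiable schedule on $[0,1]$ with $\alpha_t\in(0,1)$ for $t\in(0,1)$, $\alpha'_t=\frac{d}{dt}\alpha_t$. $\delta_a(x)=1$ if $x=a$ and $0$ otherwise. Coordinates are noised independently: $q(x_t\mid x_0)=\prod_kq_t(x_t^{(k)}\mid x_0^{(k)})$. The single-token forward rate matrix (with $R_t(x,y)$ the rate from $y$ to $x$) has as its only nonzero off-diagonal entries $R_t(\text{[MASK]},y)=-\alpha_t'/\alpha_t$ for $y\ne\text{[MASK]}$. For each coordinate $k$, $p^\theta(x_0^{(k)}=a\mid x_t,t)$ is a learned probability distribution over non-mask tokens $a\in\{1,\dots,K\}$ given the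 whole noisy sequence $x_t$ (assumed strictly positive, with the integrals below finite). The token-level denoising score entropy loss is $$\mathcal L^\theta_{\mathrm{DSE}}(x_0)=\int_0^1\mathbb E_{x_t\sim q(\cdot\mid x_0)}\sum_{k=1}^d\sum_{y\ne x_t^{(k)}}\left[R_t(x_t^{(k)},y)\,S_k(y)-R_t(x_t^{(k)},y)\frac{q_t(y\mid x_0^{(k)})}{q_t(x_t^{(k)}\mid x_0^{(k)})}\log S_k(y)\right]dt,$$ $$S_k(y)=\sum_{a\in\{1,\dots,K\}}\frac{q_t(y\mid a)}{q_t(x_t^{(k)}\mid a)}\,p^\theta(x_0^{(k)}=a\mid x_t,t),$$ where any term with $R_t(x_t^{(k)},y)=0$ is taken to be $0$. *)

theory Defs
  imports "HOL-Analysis.Analysis"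
begin

text \<open>
  The clean alphabet \<open>{1,\<dots>,K}\<close> is a finite type \<open>'v\<close> with \<open>K = CARD('v)\<close>; the noisy alphabet
  is \<open>'v option\<close>, where \<open>None\<close> is the mask token.  Positions are the elements of a finite type
  \<open>'d\<close> with \<open>d = CARD('d)\<close>.  The value \<open>\<alpha> t\<close> of the noise schedule is passed to the time-dependent
  single-token objects as a number \<open>a\<close>, and the value of its derivative as \<open>a'\<close>.
\<close>

definition delta :: "'a \<Rightarrow> 'a \<Rightarrow> real" where
  "delta a x = (if x = a then 1 else 0)"

text \<open>\<open>token_marginal a x x0\<close> is \<open>q\<^sub>t(x | x0)\<close>.\<close>

definition token_marginal :: "real \<Rightarrow> 'v option \<Rightarrow> 'v \<Rightarrow> real" where
  "token_marginal a x x0 = a * delta (Some x0) x + (1 - a) * delta None x"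

definition seq_marginal :: "real \<Rightarrow> ('d::finite \<Rightarrow> 'v option) \<Rightarrow> ('d \<Rightarrow> 'v) \<Rightarrow> real" where
  "seq_marginal a x x0 = (\<Prod>k\<in>UNIV. token_marginal a (x k) (x0 k))"

definition noisy_expectation ::
  "real \<Rightarrow> ('d::finite \<Rightarrow> 'v::finite) \<Rightarrow> (('d \<Rightarrow> 'v option) \<Rightarrow> real) \<Rightarrow> real" where
  "noisy_expectation a x0 f = (\<Sum>x\<in>UNIV. seq_marginal a x x0 * f x)"

text \<open>
  \<open>rate a a' x y\<close> is the rate from \<open>y\<close> to \<open>x\<close>; the diagonal makes every column sum to zero.
\<close>

definition rate :: "real \<Rightarrow> real \<Rightarrow> 'v option \<Rightarrow> 'v option \<Rightarrow> real" where
  "rate a a' x y =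
     (if y = None then 0
      else if x = None then - a' / a
      else if x = y then a' / a
      else 0)"

text \<open>
  A learned model \<open>p\<close> assigns to a time \<open>t\<close>, a noisy sequence \<open>x\<close> and a position \<open>k\<close> the
  distribution \<open>p t x k\<close> of the clean token at position \<open>k\<close>.
\<close>

type_synonym ('d, 'v) model = "real \<Rightarrow> ('d \<Rightarrow> 'v option) \<Rightarrow> 'd \<Rightarrow> 'v \<Rightarrow> real"

definition admissible_model :: "('d::finite, 'v::finite) model \<Rightarrow> bool" where
  "admissible_model p \<longleftrightarrow>
     (\<forall>t\<in>{0..1}. \<forall>x k. (\<forall>b. p t x k b > 0) \<and> (\<Sum>b\<in>UNIV. p t x k b) = 1)"

text \<open>\<open>score a x y \<pi>\<close> is \<open>S\<^sub>k(y)\<close> for current token \<open>x\<close> and predicted distribution \<open>\<pi>\<close>.\<close>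

definition score :: "real \<Rightarrow> 'v option \<Rightarrow> 'v option \<Rightarrow> ('v::finite \<Rightarrow> real) \<Rightarrow> real" where
  "score a x y \<pi> = (\<Sum>b\<in>UNIV. token_marginal a y b / token_marginal a x b * \<pi> b)"

definition dse_integrand ::
  "(real \<Rightarrow> real) \<Rightarrow> (real \<Rightarrow> real) \<Rightarrow> ('d::finite, 'v::finite) model \<Rightarrow> ('d \<Rightarrow> 'v) \<Rightarrow> real \<Rightarrow> real"
where
  "dse_integrand \<alpha> \<alpha>' p x0 t =
     noisy_expectation (\<alpha> t) x0 (\<lambda>x.
       \<Sum>k\<in>UNIV. \<Sum>y\<in>UNIV - {x k}.
         (let R = rate (\<alpha> t) (\<alpha>' t) (x k) y; S = score (\<alpha> t) (x k) y (p t x k) in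
          if R = 0 then 0
          else R * S
             - R * (token_marginal (\<alpha> t) y (x0 k) / token_marginal (\<alpha> t) (x k) (x0 k)) * ln S))"

definition mlm_integrand ::
  "(real \<Rightarrow> real) \<Rightarrow> (real \<Rightarrow> real) \<Rightarrow> ('d::finite, 'v::finite) model \<Rightarrow> ('d \<Rightarrow> 'v) \<Rightarrow> real \<Rightarrow> real"
where
  "mlm_integrand \<alpha> \<alpha>' p x0 t =
     noisy_expectation (\<alpha> t) x0 (\<lambda>x.
       \<alpha>' t / (1 - \<alpha> t) * (\<Sum>k\<in>UNIV. delta None (x k) * ln (p t x k (x0 k))))"

definition dse_loss ::
  "(real \<Rightarrow> real) \<Rightarrow> (real \<Rightarrow> real) \<Rightarrow> ('d::finite, 'v::finite) model \<Rightarrow> ('d \<Rightarrow> 'v) \<Rightarrow> real"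
where
  "dse_loss \<alpha> \<alpha>' p x0 = (LINT t:{0..1}|lebesgue. dse_integrand \<alpha> \<alpha>' p x0 t)"

definition mlm_loss ::
  "(real \<Rightarrow> real) \<Rightarrow> (real \<Rightarrow> real) \<Rightarrow> ('d::finite, 'v::finite) model \<Rightarrow> ('d \<Rightarrow> 'v) \<Rightarrow> real"
where
  "mlm_loss \<alpha> \<alpha>' p x0 = (LINT t:{0..1}|lebesgue. mlm_integrand \<alpha> \<alpha>' p x0 t)"

end

theory Submission
  imports Defs "HOL-Real_Asymp.Real_Asymp"
begin

text \<open>
  Only masked positions contribute to the score entropy, and there
  \<open>S\<^sub>k(Some b) = \<alpha>/(1 - \<alpha>) * p b\<close>.  Since \<open>p\<close> sums to one and the true token has ratio
  \<open>\<alpha>/(1 - \<alpha>)\<close>, such a position contributes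
  \<open>\<alpha>'/(1 - \<alpha>) * (ln p(x0) + ln (\<alpha>/(1 - \<alpha>)) - 1)\<close>.  A position is masked with
  probability \<open>1 - \<alpha>\<close>, so the two integrands differ by \<open>d * \<alpha>' * (ln (\<alpha>/(1 - \<alpha>)) - 1)\<close>
  for \<open>0 < t < 1\<close>.  This is integrable even when \<open>\<alpha>\<close> reaches 0 or 1 at the endpoints: each of
  \<open>\<alpha>' ln \<alpha>\<close>, \<open>\<alpha>' ln (1 - \<alpha>)\<close> and \<open>\<alpha>'\<close> has constant sign and a continuous antiderivative,
  because \<open>u ln u\<close> is continuous at 0.
\<close>

lemma continuous_on_x_ln_x: "continuous_on {0..} (\<lambda>x::real. x * ln x)"
proof -
  have "continuous (at x within {0..}) (\<lambda>x. x * ln x)" if "x \<ge> 0" for x :: real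
  proof (cases "x = 0")
    case True
    \<comment> \<open>The value at 0 is 0 because of the factor \<open>x\<close>, so only the
      one-sided limit matters.\<close>
    have "((\<lambda>x::real. x * ln x) \<longlongrightarrow> 0) (at_right 0)"
      by real_asymp
    then show ?thesis
      using True by (simp add: continuous_within at_within_Ici_at_right)
  next
    case False
    then show ?thesis by (intro continuous_intros) auto
  qed
  then show ?thesis
    by (simp add: continuous_on_eq_continuous_within)
qed

lemma has_real_derivative_x_ln_x:
  assumes "(u has_real_derivative u') (at t)" "u t > 0"
  shows "((\<lambda>t. u t * ln (u t)) has_real_derivative u' * (ln (u t) + 1)) (at t)"
  using assms by (auto intro!: derivative_eq_intros simp: field_simps)

text \<open>The fundamental theorem needs derivatives only in the open interval, so
  \<open>F'\<close> may blow up at the endpoints; its sign turns gauge integrability into absolute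
  integrability.\<close>

lemma absolutely_integrable_nonneg_derivative:
  fixes F F' :: "real \<Rightarrow> real"
  assumes "a \<le> b" "continuous_on {a..b} F"
    and "\<And>x. x \<in> {a<..<b} \<Longrightarrow> (F has_real_derivative F' x) (at x)"
    and "\<And>x. x \<in> {a<..<b} \<Longrightarrow> F' x \<ge> 0"
  shows "F' absolutely_integrable_on {a..b}"
proof -
  \<comment> \<open>Nothing is assumed about \<open>F'\<close> at \<open>a\<close> and
    \<open>b\<close>; the value 0 there makes the sign condition hold on the whole closed
    interval.\<close>
  define G where "G x = (if x \<in> {a, b} then 0 else F' x)" for x
  have "(G has_integral (F b - F a)) {a..b}"
    by (rule fundamental_theorem_of_calculus_interior)
      (use assms in \<open>auto simp: G_def has_real_derivative_iff_has_vector_derivative\<close>)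
  then have "G absolutely_integrable_on {a..b}"
    by (intro nonnegative_absolutely_integrable_1)
      (use assms in \<open>auto simp: G_def integrable_on_def\<close>)
  then show ?thesis
    by (rule absolutely_integrable_spike[where S = "{a, b}"]) (auto simp: G_def)
qed

lemma schedule_remainder_integrable:
  fixes \<alpha> \<alpha>' :: "real \<Rightarrow> real"
  assumes anti: "antimono_on {0..1} \<alpha>"
    and deriv: "\<And>t. t \<in> {0..1} \<Longrightarrow> (\<alpha> has_real_derivative \<alpha>' t) (at t within {0..1})"
    and range: "\<And>t. t \<in> {0<..<1} \<Longrightarrow> \<alpha> t \<in> {0<..<1}"
  shows "(\<lambda>t. \<alpha>' t * (ln (\<alpha> t) - ln (1 - \<alpha> t) - 1)) absolutely_integrable_on {0..1}"
proof -
  have cont: "continuous_on {0..1} \<alpha>"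
    using deriv by (meson continuous_on_eq_continuous_within DERIV_continuous)
  \<comment> \<open>Continuity extends the open-interval bound to the endpoints, where \<alpha> may
    equal 0 or 1.\<close>
  have "\<alpha> ` closure {0<..<1} \<subseteq> {0..1}"
    by (rule image_closure_subset) (use cont range in \<open>force+\<close>)
  then have range': "\<alpha> t \<in> {0..1}" if "t \<in> {0..1}" for t
    using that by (force simp: image_subset_iff)
  have D [derivative_intros]: "(\<alpha> has_real_derivative \<alpha>' t) (at t)" if "t \<in> {0<..<1}" for t
    using deriv[of t] that by (simp add: at_within_Icc_at)
  have nonpos: "\<alpha>' t \<le> 0" if "t \<in> {0<..<1}" for t
  proof -
    have "- \<alpha>' t \<ge> 0"
    proof (rule mono_on_imp_deriv_nonneg)
      show "mono_on {0..1} (\<lambda>t. - \<alpha> t)"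
        using anti by (auto simp: monotone_on_def)
      show "((\<lambda>t. - \<alpha> t) has_real_derivative - \<alpha>' t) (at t)"
        using that by (auto intro!: derivative_eq_intros)
      show "t \<in> interior {0..1}"
        using that by simp
    qed
    then show ?thesis by simp
  qed
  note cont_x_ln_x = continuous_on_compose2[OF continuous_on_x_ln_x]
  have 1: "(\<lambda>t. \<alpha>' t * ln (\<alpha> t)) absolutely_integrable_on {0..1}"
  proof (rule absolutely_integrable_nonneg_derivative)
    \<comment> \<open>The antiderivative \<open>u * ln u - u\<close> of \<open>ln u\<close>,
      composed with \<alpha>.\<close>
    show "continuous_on {0..1} (\<lambda>t. \<alpha> t * ln (\<alpha> t) - \<alpha> t)"
      by (intro continuous_intros cont_x_ln_x cont) (use range' in auto)
    fix t :: real assume t: "t \<in> {0<..<1}"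
    show "((\<lambda>t. \<alpha> t * ln (\<alpha> t) - \<alpha> t) has_real_derivative \<alpha>' t * ln (\<alpha> t)) (at t)"
      using DERIV_diff[OF has_real_derivative_x_ln_x[OF D[OF t]] D[OF t]] range[OF t]
      by (simp add: algebra_simps)
    show "0 \<le> \<alpha>' t * ln (\<alpha> t)"
      using nonpos[OF t] range[OF t] by (auto intro!: mult_nonpos_nonpos)
  qed simp
  have 2: "(\<lambda>t. \<alpha>' t * ln (1 - \<alpha> t)) absolutely_integrable_on {0..1}"
  proof (rule absolutely_integrable_nonneg_derivative)
    \<comment> \<open>With \<open>u = 1 - \<alpha>\<close> the antiderivative is
      \<open>- u * ln u - \<alpha>\<close>: differentiating the first term leaves an extra
      \<open>\<alpha>'\<close>, which the second removes.\<close>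
    show "continuous_on {0..1} (\<lambda>t. - ((1 - \<alpha> t) * ln (1 - \<alpha> t)) - \<alpha> t)"
      by (intro continuous_intros cont_x_ln_x cont) (use range' in auto)
    fix t :: real assume t: "t \<in> {0<..<1}"
    show "((\<lambda>t. - ((1 - \<alpha> t) * ln (1 - \<alpha> t)) - \<alpha> t) has_real_derivative
        \<alpha>' t * ln (1 - \<alpha> t)) (at t)"
    proof -
      have "((\<lambda>t. 1 - \<alpha> t) has_real_derivative - \<alpha>' t) (at t)"
        using t by (auto intro!: derivative_eq_intros)
      from DERIV_diff[OF DERIV_minus[OF has_real_derivative_x_ln_x[OF this]] D[OF t]] range[OF t]
      show ?thesis by (simp add: algebra_simps)
    qed
    show "0 \<le> \<alpha>' t * ln (1 - \<alpha> t)"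
      using nonpos[OF t] range[OF t] by (auto intro!: mult_nonpos_nonpos)
  qed simp
  have "(\<lambda>t. - \<alpha>' t) absolutely_integrable_on {0..1}"
  proof (rule absolutely_integrable_nonneg_derivative)
    show "continuous_on {0..1} (\<lambda>t. - \<alpha> t)"
      by (intro continuous_intros cont)
    show "((\<lambda>t. - \<alpha> t) has_real_derivative - \<alpha>' t) (at t)" if "t \<in> {0<..<1}" for t
      using that by (auto intro!: derivative_eq_intros)
  qed (use nonpos in auto)
  from set_integral_add(1)[OF set_integral_diff(1)[OF 1 2] this] show ?thesis
    by (simp add: algebra_simps)
qed

lemma sum_token_marginal:
  fixes b :: "'v::finite"
  shows "(\<Sum>x\<in>UNIV. token_marginal a x b) = 1"
  by (simp add: token_marginal_def delta_def sum.distrib sum_distrib_left[symmetric])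

text \<open>Coordinates are independent, so the sum over sequences factors into a product of sums
  over tokens, and every factor other than the one at \<open>k\<close> is a total mass 1.\<close>

lemma noisy_expectation_coordinate:
  fixes x0 :: "'d::finite \<Rightarrow> 'v::finite"
  shows "noisy_expectation a x0 (\<lambda>x. g (x k)) = (\<Sum>y\<in>UNIV. token_marginal a y (x0 k) * g y)"
proof -
  define f where "f j y = token_marginal a y (x0 j) * (if j = k then g y else 1)" for j y
  have "noisy_expectation a x0 (\<lambda>x. g (x k)) = (\<Sum>x\<in>UNIV. \<Prod>j\<in>UNIV. f j (x j))"
    by (simp add: noisy_expectation_def seq_marginal_def f_def prod.distrib prod.delta)
  also have "\<dots> = (\<Prod>j\<in>UNIV. \<Sum>y\<in>UNIV. f j y)"
    using prod_sum_PiE[of UNIV "\<lambda>_. UNIV" f] by simp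
  also have "\<dots> = (\<Prod>j\<in>UNIV. if j = k then \<Sum>y\<in>UNIV. token_marginal a y (x0 k) * g y else 1)"
    by (intro prod.cong) (auto simp: f_def sum_token_marginal)
  also have "\<dots> = (\<Sum>y\<in>UNIV. token_marginal a y (x0 k) * g y)"
    by simp
  finally show ?thesis .
qed

lemma noisy_expectation_mask:
  "noisy_expectation a x0 (\<lambda>x. delta None (x k)) = 1 - a"
  unfolding noisy_expectation_coordinate
  by (simp add: token_marginal_def delta_def UNIV_option_conv sum.reindex)

lemma dse_token_eq:
  fixes \<pi> :: "'v::finite \<Rightarrow> real"
  assumes a: "0 < a" "a < 1" and pos: "\<And>b. \<pi> b > 0" and sum1: "(\<Sum>b\<in>UNIV. \<pi> b) = 1"
  shows "(\<Sum>y\<in>UNIV - {x}.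
         (let R = rate a a' x y; S = score a x y \<pi> in
          if R = 0 then 0
          else R * S - R * (token_marginal a y b0 / token_marginal a x b0) * ln S))
       = a' / (1 - a) * (delta None x * ln (\<pi> b0))
         + a' / (1 - a) * (ln a - ln (1 - a) - 1) * delta None x"
proof (cases x)
  case (Some w)
  \<comment> \<open>Off the diagonal, only the mask has incoming rate, so an unmasked position
    contributes nothing.\<close>
  have "rate a a' (Some w) y = 0" if "y \<noteq> Some w" for y
    using that by (auto simp: rate_def)
  then show ?thesis
    by (simp add: Some delta_def Let_def)
next
  case None
  \<comment> \<open>Every denominator is the mask probability \<open>1 - a\<close>, and only the
    summand \<open>b = v\<close> has a nonzero numerator.\<close>
  have score: "score a None (Some v) \<pi> = a / (1 - a) * \<pi> v" for v
    by (simp add: score_def token_marginal_def delta_def if_distrib if_distribR cong: if_cong)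
  have ln_score: "ln (a / (1 - a) * \<pi> b0) = ln a - ln (1 - a) + ln (\<pi> b0)"
    using a pos[of b0] by (simp add: ln_mult ln_div)
  \<comment> \<open>With \<open>R = - a' / a\<close>, the first summand is \<open>R * S\<close>. The
    logarithmic term survives only at \<open>v = b0\<close>, since other tokens have marginal 0
    given \<open>b0\<close>. For \<open>a' = 0\<close> both summands vanish, in agreement with the
    convention for \<open>R = 0\<close>.\<close>
  let ?s = "\<lambda>v. - a' / (1 - a) * \<pi> v
      + (if v = b0 then a' / (1 - a) * ln (a / (1 - a) * \<pi> b0) else 0)"
  have "(\<Sum>y\<in>UNIV - {x}.
         (let R = rate a a' x y; S = score a x y \<pi> in
          if R = 0 then 0
          else R * S - R * (token_marginal a y b0 / token_marginal a x b0) * ln S))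
      = (\<Sum>v\<in>UNIV. ?s v)"
    unfolding None
    by (rule sum.reindex_cong[of Some])
      (use a in \<open>auto simp: UNIV_option_conv Let_def rate_def score token_marginal_def delta_def\<close>)
  also have "\<dots> = - a' / (1 - a) + a' / (1 - a) * ln (a / (1 - a) * \<pi> b0)"
    by (simp only: sum.distrib sum_distrib_left[symmetric] sum1) simp
  also have "\<dots> = a' / (1 - a) * (delta None x * ln (\<pi> b0))
         + a' / (1 - a) * (ln a - ln (1 - a) - 1) * delta None x"
    unfolding ln_score None by (simp add: delta_def algebra_simps diff_divide_distrib add_divide_distrib)
  finally show ?thesis .
qed

lemma dse_integrand_eq:
  fixes p :: "('d::finite, 'v::finite) model"
  assumes p: "admissible_model p" and t: "t \<in> {0..1}" and a: "0 < \<alpha> t" "\<alpha> t < 1"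
  shows "dse_integrand \<alpha> \<alpha>' p x0 t = mlm_integrand \<alpha> \<alpha>' p x0 t
           + real CARD('d) * (\<alpha>' t * (ln (\<alpha> t) - ln (1 - \<alpha> t) - 1))"
proof -
  let ?c = "\<alpha>' t / (1 - \<alpha> t) * (ln (\<alpha> t) - ln (1 - \<alpha> t) - 1)"
  have pos: "p t x k b > 0" and sum1: "(\<Sum>b\<in>UNIV. p t x k b) = 1" for x k b
    using p t by (auto simp: admissible_model_def)
  have "dse_integrand \<alpha> \<alpha>' p x0 t = noisy_expectation (\<alpha> t) x0 (\<lambda>x.
      \<alpha>' t / (1 - \<alpha> t) * (\<Sum>k\<in>UNIV. delta None (x k) * ln (p t x k (x0 k)))
      + ?c * (\<Sum>k\<in>UNIV. delta None (x k)))"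
    unfolding dse_integrand_def dse_token_eq[OF a pos sum1]
    by (simp only: sum.distrib sum_distrib_left)
  also have "\<dots> = mlm_integrand \<alpha> \<alpha>' p x0 t
      + ?c * (\<Sum>k\<in>UNIV. noisy_expectation (\<alpha> t) x0 (\<lambda>x. delta None (x k)))"
  proof -
    have "(\<Sum>k\<in>UNIV. noisy_expectation (\<alpha> t) x0 (\<lambda>x. delta None (x k)))
        = (\<Sum>x\<in>UNIV. seq_marginal (\<alpha> t) x x0 * (\<Sum>k\<in>UNIV. delta None (x k)))"
      unfolding noisy_expectation_def by (subst sum.swap) (simp only: sum_distrib_left)
    moreover have "noisy_expectation a x0 (\<lambda>x. f x + c * g x)
        = noisy_expectation a x0 f + c * (\<Sum>x\<in>UNIV. seq_marginal a x x0 * g x)" for a c f g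
      by (simp add: noisy_expectation_def sum.distrib sum_distrib_left algebra_simps)
    ultimately show ?thesis
      unfolding mlm_integrand_def by (simp only:)
  qed
  \<comment> \<open>The expected number of masked positions cancels the denominator
    \<open>1 - \<alpha> t\<close> of \<open>?c\<close>.\<close>
  also have "(\<Sum>k\<in>UNIV. noisy_expectation (\<alpha> t) x0 (\<lambda>x. delta None (x k)))
      = real CARD('d) * (1 - \<alpha> t)"
    by (simp add: noisy_expectation_mask)
  finally show ?thesis
    using a by simp
qed

theorem mainTheorem7:
  fixes \<alpha> \<alpha>' :: "real \<Rightarrow> real"
    and x0 :: "'d::finite \<Rightarrow> 'v::finite"
  assumes "antimono_on {0..1} \<alpha>"
    and "\<And>t. t \<in> {0..1} \<Longrightarrow> (\<alpha> has_real_derivative \<alpha>' t) (at t within {0..1})"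
    and "\<And>t. t \<in> {0<..<1} \<Longrightarrow> \<alpha> t \<in> {0<..<1}"
  shows "\<exists>C::real. \<forall>p\<theta> :: ('d, 'v) model.
           admissible_model p\<theta> \<longrightarrow>
           set_integrable lebesgue {0..1} (dse_integrand \<alpha> \<alpha>' p\<theta> x0) \<longrightarrow>
             set_integrable lebesgue {0..1} (mlm_integrand \<alpha> \<alpha>' p\<theta> x0) \<and>
             dse_loss \<alpha> \<alpha>' p\<theta> x0 = mlm_loss \<alpha> \<alpha>' p\<theta> x0 + C"
proof -
  \<comment> \<open>The pointwise gap between the integrands does not involve the model; its
    integral is the witness for \<open>C\<close>.\<close>
  define c where "c t = real CARD('d) * (\<alpha>' t * (ln (\<alpha> t) - ln (1 - \<alpha> t) - 1))" for t
  have c: "set_integrable lebesgue {0..1} c"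
    unfolding c_def by (intro set_integrable_mult_right schedule_remainder_integrable assms)
  show ?thesis
  proof (intro exI allI impI)
    fix p :: "('d, 'v) model"
    assume p: "admissible_model p"
      and dse: "set_integrable lebesgue {0..1} (dse_integrand \<alpha> \<alpha>' p x0)"
    \<comment> \<open>The endpoints are excluded because \<open>\<alpha> t\<close> may be 0 or 1
      there; as a null set they affect neither integrability nor the integrals.\<close>
    have eq: "mlm_integrand \<alpha> \<alpha>' p x0 t = dse_integrand \<alpha> \<alpha>' p x0 t - c t"
      if "t \<in> {0..1} - {0, 1}" for t
      using that assms(3)[of t] dse_integrand_eq[OF p, of t \<alpha> \<alpha>' x0] by (auto simp: c_def)
    have mlm: "set_integrable lebesgue {0..1} (mlm_integrand \<alpha> \<alpha>' p x0)"
      by (rule absolutely_integrable_spike[where S = "{0, 1}", OF set_integral_diff(1)[OF dse c]])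
        (use eq in auto)
    \<comment> \<open>Passing to the gauge integral allows the integrand to be changed at the two
      endpoints.\<close>
    have "mlm_loss \<alpha> \<alpha>' p x0 = integral {0..1} (\<lambda>t. dse_integrand \<alpha> \<alpha>' p x0 t - c t)"
      unfolding mlm_loss_def set_lebesgue_integral_eq_integral(2)[OF mlm]
      by (rule integral_spike[of "{0, 1}"]) (use eq in auto)
    also have "\<dots> = dse_loss \<alpha> \<alpha>' p x0 - (LINT t:{0..1}|lebesgue. c t)"
      using set_lebesgue_integral_eq_integral(2)[OF set_integral_diff(1)[OF dse c]]
        set_integral_diff(2)[OF dse c] by (simp add: dse_loss_def)
    finally show "set_integrable lebesgue {0..1} (mlm_integrand \<alpha> \<alpha>' p x0) \<and>
        dse_loss \<alpha> \<alpha>' p x0 = mlm_loss \<alpha> \<alpha>' p x0 + (LINT t:{0..1}|lebesgue. c t)"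
      using mlm by simp
  qed
qed

end
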